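(* Let $G$ be a nice graph. Then, for every set $W$ of $2\cdot|E(G)|$ distinct strictly positive integers, there exists an edge-injective neighbour-sum-distinguishing $W$-edge-weighting of $G$. In particular, $\chi^{e,1}_\Sigma(G)\leq 2\cdot|E(G)|$.
   Context: All graphs are finite, simple, undirected and loopless. A graph is nice if none of its connected components is isomorphic to $K_2$. For a set $W$ of weights, a $W$-edge-weighting of $G$ is a map $w:E(G)\to W$; a $k$-edge-weighting is a $\{1,\dots,k\}$-edge-weighting. For a vertex $v$, $\sigma_w(v)=\sum_{u\in N(v)} w(vu)$. The weighting $w$ is neighbour-sum-distinguishing if $\sigma_w(u)\neq\sigma_w(v)$ for every edge $uv$, and edge-injective if no two distinct edges receive the same weight. For a nice graph $G$, $\chi^{e,1}_\Sigma(G)$ is the smallest $k$ such that $G$ admits an edge-injective neighbour-sum-distinguishing $k$-edge-weighting. *)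

theory Defs
  imports Main
begin

record 'a ugraph =
  verts :: "'a set"
  edges :: "'a set set"

definition simple_graph :: "'a ugraph \<Rightarrow> bool" where
  "simple_graph G \<longleftrightarrow>
     finite (verts G) \<and> (\<forall>e \<in> edges G. e \<subseteq> verts G \<and> card e = 2)"

definition adj :: "'a ugraph \<Rightarrow> ('a \<times> 'a) set" where
  "adj G = {(u, v). {u, v} \<in> edges G}"

definition neighbours :: "'a ugraph \<Rightarrow> 'a \<Rightarrow> 'a set" where
  "neighbours G v = {u. {v, u} \<in> edges G}"

definition induced_subgraph :: "'a ugraph \<Rightarrow> 'a set \<Rightarrow> 'a ugraph" where
  "induced_subgraph G C = \<lparr>verts = C, edges = {e \<in> edges G. e \<subseteq> C}\<rparr>"

definition components :: "'a ugraph \<Rightarrow> 'a ugraph set" where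
  "components G =
     {induced_subgraph G {v \<in> verts G. (u, v) \<in> (adj G)\<^sup>*} | u. u \<in> verts G}"

definition graph_iso :: "'a ugraph \<Rightarrow> 'b ugraph \<Rightarrow> bool" where
  "graph_iso G H \<longleftrightarrow>
     (\<exists>f. bij_betw f (verts G) (verts H) \<and>
          (\<forall>u \<in> verts G. \<forall>v \<in> verts G. {u, v} \<in> edges G \<longleftrightarrow> {f u, f v} \<in> edges H))"

definition complete_graph :: "nat \<Rightarrow> nat ugraph" where
  "complete_graph n = \<lparr>verts = {..<n}, edges = {e. e \<subseteq> {..<n} \<and> card e = 2}\<rparr>"

definition nice :: "'a ugraph \<Rightarrow> bool" where
  "nice G \<longleftrightarrow> (\<forall>C \<in> components G. \<not> graph_iso C (complete_graph 2))"

text \<open>A weighting is a total function on vertex sets; only its values on edges matter.\<close>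

definition edge_weighting :: "'a ugraph \<Rightarrow> nat set \<Rightarrow> ('a set \<Rightarrow> nat) \<Rightarrow> bool" where
  "edge_weighting G W w \<longleftrightarrow> (\<forall>e \<in> edges G. w e \<in> W)"

definition vertex_sum :: "'a ugraph \<Rightarrow> ('a set \<Rightarrow> nat) \<Rightarrow> 'a \<Rightarrow> nat" where
  "vertex_sum G w v = (\<Sum>u \<in> neighbours G v. w {v, u})"

definition nsd :: "'a ugraph \<Rightarrow> ('a set \<Rightarrow> nat) \<Rightarrow> bool" where
  "nsd G w \<longleftrightarrow> (\<forall>u v. {u, v} \<in> edges G \<longrightarrow> vertex_sum G w u \<noteq> vertex_sum G w v)"

definition edge_injective :: "'a ugraph \<Rightarrow> ('a set \<Rightarrow> nat) \<Rightarrow> bool" where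
  "edge_injective G w \<longleftrightarrow> inj_on w (edges G)"

text \<open>The bound \<open>k = 0\<close> is allowed; it is attained exactly by the edgeless graphs.\<close>

definition chi_e1 :: "'a ugraph \<Rightarrow> nat" where
  "chi_e1 G = (LEAST k. \<exists>w. edge_weighting G {1..k} w \<and> edge_injective G w \<and> nsd G w)"

end

theory Submission imports Defs begin

text \<open>For an edge \<open>f = {x, y}\<close> the weight of \<open>f\<close> cancels in the comparison of the sums at \<open>x\<close>
  and \<open>y\<close>, so the condition at \<open>f\<close> only concerns the edges adjacent to \<open>f\<close>; in a nice graph
  there is at least one. Weight the edges greedily in any order. When an edge \<open>e\<close> receives its
  weight, the edges weighted before forbid at most \<open>|E| - 1\<close> values, and each edge \<open>f \<noteq> e\<close>
  forbids at most one further value, namely if \<open>e\<close> is the last edge adjacent to \<open>f\<close> to be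
  weighted. At most \<open>2|E| - 2\<close> values are forbidden in total.\<close>

text \<open>Graph-free form of the greedy argument: \<open>E\<close> is to be the edge set,
  \<open>A f\<close> and \<open>B f\<close> the edges other than \<open>f\<close> at the two ends of
  \<open>f\<close>.\<close>

lemma greedy_injective_weighting:
  fixes A B :: "'b \<Rightarrow> 'b set" and W :: "nat set"
  assumes fin: "finite E" and sub: "\<And>f. f \<in> E \<Longrightarrow> A f \<union> B f \<subseteq> E - {f}"
    and disj: "\<And>f. f \<in> E \<Longrightarrow> A f \<inter> B f = {}"
    and ne: "\<And>f. f \<in> E \<Longrightarrow> A f \<union> B f \<noteq> {}"
    and W: "2 * card E \<le> Suc (card W)"
  obtains w where "inj_on w E" "w ` E \<subseteq> W" "\<And>f. f \<in> E \<Longrightarrow> sum w (A f) \<noteq> sum w (B f)"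
proof -
  \<comment> \<open>The condition at \<open>f\<close> is demanded only once all of
    \<open>A f \<union> B f\<close> is weighted. For \<open>S = {}\<close> it is vacuous by
    \<open>ne\<close>; for \<open>S = E\<close> it is the full claim.\<close>
  have "\<exists>w. inj_on w S \<and> w ` S \<subseteq> W \<and>
          (\<forall>f\<in>E. A f \<union> B f \<subseteq> S \<longrightarrow> sum w (A f) \<noteq> sum w (B f))"
    if "finite S" "S \<subseteq> E" for S
    using that
  proof (induction S rule: finite_induct)
    case empty
    then show ?case using ne by (intro exI[of _ undefined]) (auto simp del: Un_empty)
  next
    case (insert e S)
    then obtain w where inj: "inj_on w S" and ran: "w ` S \<subseteq> W"
      and good: "\<And>f. f \<in> E \<Longrightarrow> A f \<union> B f \<subseteq> S \<Longrightarrow> sum w (A f) \<noteq> sum w (B f)"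
      by auto
    \<comment> \<open>If \<open>e\<close> lies in \<open>A f \<union> B f\<close>, no other value at
      \<open>e\<close> can balance the two sums. Where the subtraction truncates, no value balances
      them and forbidding \<open>0\<close> is harmless.\<close>
    define bad where "bad f = (if e \<in> A f then sum w (B f) - sum w (A f - {e})
                               else sum w (A f) - sum w (B f - {e}))" for f
    define F where "F = w ` S \<union> bad ` (E - {e})"
    have "finite F" using insert.hyps fin by (simp add: F_def)
    have "card F \<le> card S + card (E - {e})"
      unfolding F_def using insert.hyps fin
      by (intro order_trans[OF card_Un_le] add_mono card_image_le) auto
    moreover have "card (E - {e}) = card E - 1" "card E > 0"
      using insert.prems fin by (auto simp: card_gt_0_iff)
    \<comment> \<open>Since \<open>e\<close> is not in \<open>S\<close>, at most
      \<open>2 * card E - 2\<close> values are forbidden, while \<open>W\<close> has at least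
      \<open>2 * card E - 1\<close>.\<close>
    moreover have "Suc (card S) \<le> card E"
      using card_mono[OF fin insert.prems] insert.hyps by simp
    ultimately have "card F < card W" using W by linarith
    then obtain c where c: "c \<in> W" "c \<notin> F"
      using card_mono[OF \<open>finite F\<close>, of W] by (meson not_le subsetI)
    define w' where "w' = w(e := c)"
    have sum_eq: "sum w' X = sum w X" if "e \<notin> X" for X
      using that by (intro sum.cong) (auto simp: w'_def)
    have sum_split: "sum w' X = c + sum w (X - {e})" if "e \<in> X" "finite X" for X
      using that sum_eq[of "X - {e}"] sum.remove[of X e w'] by (simp add: w'_def)
    have "sum w' (A f) \<noteq> sum w' (B f)" if f: "f \<in> E" "A f \<union> B f \<subseteq> insert e S" for f
    proof (cases "e \<in> A f \<union> B f")
      case False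
      then have "A f \<union> B f \<subseteq> S" using f by auto
      then show ?thesis using False good f by (simp add: sum_eq)
    next
      case True
      have fin': "finite (A f)" "finite (B f)"
        using f(2) insert.hyps(1) by (auto intro: finite_subset[of _ "insert e S"])
      \<comment> \<open>The weight of \<open>e\<close> does not enter the condition at
        \<open>e\<close>, so \<open>bad\<close> is only needed on \<open>E - {e}\<close>.\<close>
      have "f \<noteq> e" using True sub[OF f(1)] by auto
      then have "c \<noteq> bad f" using c f by (auto simp: F_def)
      then show ?thesis
      proof (cases "e \<in> A f")
        case True
        moreover have "e \<notin> B f" using True disj[OF f(1)] by auto
        ultimately show ?thesis
          using \<open>c \<noteq> bad f\<close> fin' by (auto simp: bad_def sum_eq sum_split)
      next
        case False
        then have "e \<in> B f" using True by auto
        then show ?thesis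
          using False \<open>c \<noteq> bad f\<close> fin' by (auto simp: bad_def sum_eq sum_split)
      qed
    qed
    moreover have "inj_on w' (insert e S)"
      using inj c insert.hyps by (auto simp: w'_def F_def inj_on_def)
    moreover have "w' ` insert e S \<subseteq> W"
      using ran c by (auto simp: w'_def)
    ultimately show ?case by blast
  qed
  from this[OF fin order_refl] obtain w where "inj_on w E" "w ` E \<subseteq> W"
    and good: "\<forall>f\<in>E. A f \<union> B f \<subseteq> E \<longrightarrow> sum w (A f) \<noteq> sum w (B f)" by auto
  moreover have "A f \<union> B f \<subseteq> E" if "f \<in> E" for f
    using sub[OF that] by auto
  ultimately show thesis using that by simp
qed

lemma finite_edges: "simple_graph G \<Longrightarrow> finite (edges G)"
  unfolding simple_graph_def by (meson Pow_iff finite_Pow_iff finite_subset subsetI)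

text \<open>The map \<open>u \<mapsto> {v, u}\<close> is a bijection from the neighbours of
  \<open>v\<close> to the edges at \<open>v\<close>. Sums over sets of edges are what the greedy
  argument handles.\<close>

lemma vertex_sum_incident:
  assumes "simple_graph G"
  shows "vertex_sum G w v = sum w {e \<in> edges G. v \<in> e}"
proof -
  have "{e \<in> edges G. v \<in> e} = (\<lambda>u. {v, u}) ` neighbours G v"
  proof (intro equalityI subsetI)
    fix e assume e: "e \<in> {e \<in> edges G. v \<in> e}"
    then have "card e = 2" using assms by (auto simp: simple_graph_def)
    then obtain u where "e = {v, u}" using e by (auto simp: card_2_iff)
    then show "e \<in> (\<lambda>u. {v, u}) ` neighbours G v" using e by (auto simp: neighbours_def)
  qed (auto simp: neighbours_def)
  moreover have "inj_on (\<lambda>u. {v, u}) (neighbours G v)"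
    by (auto simp: inj_on_def doubleton_eq_iff)
  ultimately show ?thesis by (simp add: vertex_sum_def sum.reindex)
qed

text \<open>Otherwise no walk from \<open>x\<close> leaves \<open>{x, y}\<close>, and this edge
  alone forms a component isomorphic to \<open>complete_graph 2\<close>.\<close>

lemma nice_adjacent_edge:
  assumes "simple_graph G" "nice G" and e: "{x, y} \<in> edges G"
  shows "\<exists>e'\<in>edges G. e' \<noteq> {x, y} \<and> (x \<in> e' \<or> y \<in> e')"
proof (rule ccontr)
  assume "\<not> ?thesis"
  then have iso: "e' = {x, y}" if "e' \<in> edges G" "x \<in> e' \<or> y \<in> e'" for e'
    using that by blast
  have "card {x, y} = 2" and xy: "x \<in> verts G" "y \<in> verts G"
    using assms(1) e by (auto simp: simple_graph_def)
  then have "x \<noteq> y" by auto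
  have reach: "v \<in> {x, y}" if "(x, v) \<in> (adj G)\<^sup>*" for v
    using that
  proof (induction rule: rtrancl_induct)
    case (step u v)
    then have "{u, v} = {x, y}" using iso[of "{u, v}"] by (auto simp: adj_def)
    then show ?case by auto
  qed simp
  have "(x, y) \<in> (adj G)\<^sup>*" using e by (auto simp: adj_def)
  then have comp: "{v \<in> verts G. (x, v) \<in> (adj G)\<^sup>*} = {x, y}"
    using reach xy by auto
  \<comment> \<open>\<open>graph_iso\<close> also compares pairs with \<open>u = v\<close>, where
    \<open>{u, v}\<close> collapses to a singleton.\<close>
  have noloop: "{v} \<notin> edges G" for v
    using assms(1) by (auto simp: simple_graph_def)
  have "graph_iso (induced_subgraph G {x, y}) (complete_graph 2)"
    unfolding graph_iso_def
  proof (intro exI conjI)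
    let ?h = "\<lambda>v. if v = x then 0 else 1 :: nat"
    show "bij_betw ?h (verts (induced_subgraph G {x, y})) (verts (complete_graph 2))"
      using \<open>x \<noteq> y\<close>
      by (auto simp: bij_betw_def induced_subgraph_def complete_graph_def inj_on_def)
    show "\<forall>u\<in>verts (induced_subgraph G {x, y}). \<forall>v\<in>verts (induced_subgraph G {x, y}).
        ({u, v} \<in> edges (induced_subgraph G {x, y})) =
        ({?h u, ?h v} \<in> edges (complete_graph 2))"
      using \<open>x \<noteq> y\<close> e noloop
      by (auto simp: induced_subgraph_def complete_graph_def insert_commute)
  qed
  moreover have "induced_subgraph G {x, y} \<in> components G"
    unfolding components_def using comp xy(1) by (auto intro!: exI[of _ x])
  ultimately show False using assms(2) by (auto simp: nice_def)
qed

lemma nice_graph_weighting: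
  assumes G: "simple_graph G" "nice G"
    and W: "2 * card (edges G) \<le> Suc (card W)"
  obtains w where "edge_weighting G W w" "edge_injective G w" "nsd G w"
proof -
  let ?E = "edges G"
  \<comment> \<open>Edges are unordered; \<open>p\<close> fixes which end of \<open>f\<close>
    supplies \<open>A f\<close> and which \<open>B f\<close>.\<close>
  have "\<forall>f\<in>?E. \<exists>p. f = {fst p, snd p} \<and> fst p \<noteq> snd p"
    using G(1) by (auto simp: simple_graph_def card_2_iff)
  then obtain p where p: "\<And>f. f \<in> ?E \<Longrightarrow> f = {fst (p f), snd (p f)} \<and> fst (p f) \<noteq> snd (p f)"
    by metis
  define inc where "inc v f = {e \<in> ?E. v \<in> e} - {f}" for v f
  have sub: "inc (fst (p f)) f \<union> inc (snd (p f)) f \<subseteq> ?E - {f}" for f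
    by (auto simp: inc_def)
  \<comment> \<open>An edge containing both ends of \<open>f\<close> is \<open>f\<close> itself,
    which \<open>inc\<close> removes.\<close>
  have disj: "inc (fst (p f)) f \<inter> inc (snd (p f)) f = {}" if f: "f \<in> ?E" for f
  proof -
    have "e = f" if "e \<in> ?E" "fst (p f) \<in> e" "snd (p f) \<in> e" for e
    proof -
      have "card e = 2" "card f = 2" using G(1) that f by (auto simp: simple_graph_def)
      moreover have "f \<subseteq> e" using p[OF f] that by (metis empty_subsetI insert_subset)
      ultimately show ?thesis by (metis card_subset_eq card.infinite zero_neq_numeral)
    qed
    then show ?thesis by (auto simp: inc_def)
  qed
  have ne: "inc (fst (p f)) f \<union> inc (snd (p f)) f \<noteq> {}" if f: "f \<in> ?E" for f
  proof -
    obtain e where "e \<in> ?E" "e \<noteq> f" "fst (p f) \<in> e \<or> snd (p f) \<in> e"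
      using nice_adjacent_edge[OF G, of "fst (p f)" "snd (p f)"] p[OF f] f by metis
    then show ?thesis by (auto simp: inc_def)
  qed
  obtain w where w: "inj_on w ?E" "w ` ?E \<subseteq> W"
    and good: "\<And>f. f \<in> ?E \<Longrightarrow> sum w (inc (fst (p f)) f) \<noteq> sum w (inc (snd (p f)) f)"
    using greedy_injective_weighting[OF finite_edges[OF G(1)] sub disj ne W] by blast
  \<comment> \<open>The summand \<open>w f\<close> is common to both ends of \<open>f\<close> and
    cancels, which leaves exactly \<open>good\<close>.\<close>
  have vs: "vertex_sum G w v = w f + sum w (inc v f)" if "f \<in> ?E" "v \<in> f" for v f
    unfolding vertex_sum_incident[OF G(1)] inc_def
    using that finite_edges[OF G(1)] by (intro sum.remove) auto
  have "vertex_sum G w u \<noteq> vertex_sum G w v" if uv: "{u, v} \<in> ?E" for u v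
  proof -
    let ?x = "fst (p {u, v})" and ?y = "snd (p {u, v})"
    have eq: "{u, v} = {?x, ?y}" using p[OF uv] by blast
    then have "?x \<in> {u, v}" "?y \<in> {u, v}" by blast+
    then have "vertex_sum G w ?x \<noteq> vertex_sum G w ?y"
      using good[OF uv] vs[OF uv] by simp
    \<comment> \<open>\<open>p\<close> may list the ends as \<open>(v, u)\<close>; the inequality is
      symmetric.\<close>
    then show ?thesis using eq by (metis doubleton_eq_iff)
  qed
  then show thesis
    using w by (intro that[of w]) (auto simp: edge_weighting_def edge_injective_def nsd_def)
qed

theorem theorem4p1:
  fixes G :: "'a ugraph"
  assumes "simple_graph G" and "nice G"
  shows "(\<forall>W :: nat set.
            finite W \<and> card W = 2 * card (edges G) \<and> (\<forall>x \<in> W. 0 < x) \<longrightarrow>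
            (\<exists>w. edge_weighting G W w \<and> edge_injective G w \<and> nsd G w)) \<and>
         chi_e1 G \<le> 2 * card (edges G)"
proof -
  have main: "\<exists>w. edge_weighting G W w \<and> edge_injective G w \<and> nsd G w"
    if "card W = 2 * card (edges G)" for W :: "nat set"
    using nice_graph_weighting[OF assms, of W] that by auto
  \<comment> \<open>With \<open>W = {1..2 * card (edges G)}\<close>, the number
    \<open>2 * card (edges G)\<close> is a candidate for the least \<open>k\<close>.\<close>
  moreover have "chi_e1 G \<le> 2 * card (edges G)"
    unfolding chi_e1_def by (rule Least_le, rule main) simp
  ultimately show ?thesis by blast
qed

end
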